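(* Let $Q$ be an $n$-dimensional manifold, let $H:T^*Q\to\mathbb{R}$ be a natural Hamiltonian, and let the system be subject to $k<n$ linear nonholonomic constraints given by a distribution $\mathcal{D}\subset TQ$ with local annihilating 1-forms $\eta_1,\dots,\eta_k$. Then for any closed 2-form $\mathcal{B}\in\Omega^2(Q)$, the Hamiltonian $H$ is preserved under the magnetic nonholonomic flow: if $X_{\mathcal{B}}$ is the vector field on $\mathcal{D}'\subset T^*Q$ determined by $$ i_{X_{\mathcal{B}}}\omega_{\mathcal{B}} = dH + \lambda^i\pi_Q^*\eta_i,\qquad \omega_{\mathcal{B}}=\omega+\pi_Q^*\mathcal{B}, $$ then $\mathcal{L}_{X_{\mathcal{B}}}H=0$, where $\mathcal{L}$ denotes the Lie derivative.
   Context: All objects are smooth. $\pi_Q:T^*Q\to Q$ is the cotangent bundle projection, $\omega=dq^i\wedge dp_i$ is the canonical symplectic form on $T^*Q$, and repeated indices are summed. A Hamiltonian is natural if it is of the form kinetic plus potential energy (kinetic energy given by a Riemannian metric on $Q$). $\mathcal{D}\subset TQ$ is a nonintegrable distribution, and the 1-forms $\eta_i$, $i\in\{1,\dots,k\}$, are (locally) chosen so that their span is the annihilator of $\mathcal{D}$; in particular $\eta_i(v)=0$ for all $v\in\mathcal{D}$. $\mathbb{F}H:T^*Q\to TQ$ is the fiber derivative of $H$ (in coordinates $(q,p)\mapsto(q,\partial H/\partial p)$), and $\mathcal{D}'=(\mathbb{F}H)^{-1}(\mathcal{D})\subset T^*Q$ is the induced co-distribution. The multipliers $\lambda^i$ are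 functions chosen to enforce the constraints, i.e. so that the vector field $X_{\mathcal{B}}$ is tangent to $\mathcal{D}'$. The magnetic nonholonomic flow is the flow of $X_{\mathcal{B}}$ on $\mathcal{D}'$. *)

theory Defs
  imports "HOL-Analysis.Analysis"
begin

subsection \<open>Smooth maps between Euclidean spaces\<close>

fun Ck_on :: "nat \<Rightarrow> 'a::real_normed_vector set \<Rightarrow> ('a \<Rightarrow> 'b::real_normed_vector) \<Rightarrow> bool" where
  "Ck_on 0 S f \<longleftrightarrow> continuous_on S f"
| "Ck_on (Suc k) S f \<longleftrightarrow>
     (\<forall>x\<in>S. f differentiable (at x)) \<and> (\<forall>v. Ck_on k S (\<lambda>x. frechet_derivative f (at x) v))"

text \<open>Only used for open sets \<open>S\<close> in Euclidean spaces.\<close>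

definition smooth_on :: "'a::real_normed_vector set \<Rightarrow> ('a \<Rightarrow> 'b::real_normed_vector) \<Rightarrow> bool" where
  "smooth_on S f \<longleftrightarrow> (\<forall>k. Ck_on k S f)"


subsection \<open>Manifolds\<close>

text \<open>A manifold is given by an atlas \<open>A\<close>, that is, a set of smoothly compatible bijections from
  sets of points onto open subsets of the Euclidean space \<open>'e\<close>. Its set of points is the union of
  the chart domains, its topology is the one induced by the charts, and its dimension is
  \<open>DIM('e)\<close>.\<close>

datatype ('q, 'e) chart = Chart (cdom: "'q set") (cmap: "'q \<Rightarrow> 'e")

definition cinv :: "('q, 'e) chart \<Rightarrow> 'e \<Rightarrow> 'q" where
  "cinv c = inv_into (cdom c) (cmap c)"

definition transition :: "('q, 'e) chart \<Rightarrow> ('q, 'e) chart \<Rightarrow> 'e \<Rightarrow> 'e" where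
  "transition c d = cmap d \<circ> cinv c"

definition is_chart :: "('q, 'e::euclidean_space) chart \<Rightarrow> bool" where
  "is_chart c \<longleftrightarrow> inj_on (cmap c) (cdom c) \<and> open (cmap c ` cdom c)"

definition compatible :: "('q, 'e::euclidean_space) chart \<Rightarrow> ('q, 'e) chart \<Rightarrow> bool" where
  "compatible c d \<longleftrightarrow>
     open (cmap c ` (cdom c \<inter> cdom d)) \<and> smooth_on (cmap c ` (cdom c \<inter> cdom d)) (transition c d)"

definition smooth_atlas :: "('q, 'e::euclidean_space) chart set \<Rightarrow> bool" where
  "smooth_atlas A \<longleftrightarrow> (\<forall>c\<in>A. is_chart c) \<and> (\<forall>c\<in>A. \<forall>d\<in>A. compatible c d)"

definition pts :: "('q, 'e) chart set \<Rightarrow> 'q set" where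
  "pts A = (\<Union>c\<in>A. cdom c)"

definition manifold_topology :: "('q, 'e::euclidean_space) chart set \<Rightarrow> 'q topology" where
  "manifold_topology A =
     topology (\<lambda>W. W \<subseteq> pts A \<and> (\<forall>c\<in>A. open (cmap c ` (W \<inter> cdom c))))"

lemma openin_manifold_topology:
  assumes inj: "\<And>c. c \<in> A \<Longrightarrow> inj_on (cmap c) (cdom c)"
  shows "openin (manifold_topology A) W \<longleftrightarrow>
           W \<subseteq> pts A \<and> (\<forall>c\<in>A. open (cmap c ` (W \<inter> cdom c)))"
proof -
  have Int: "cmap c ` (V \<inter> W \<inter> cdom c) = cmap c ` (V \<inter> cdom c) \<inter> cmap c ` (W \<inter> cdom c)"
    if "c \<in> A" for c V W
  proof -
    have "V \<inter> W \<inter> cdom c = (V \<inter> cdom c) \<inter> (W \<inter> cdom c)" by blast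
    then show ?thesis
      using inj_on_image_Int[OF inj[OF that], of "V \<inter> cdom c" "W \<inter> cdom c"] by simp
  qed
  have Un: "cmap c ` (\<Union>\<K> \<inter> cdom c) = (\<Union>K\<in>\<K>. cmap c ` (K \<inter> cdom c))" for c :: "('a,'b) chart" and \<K>
    by blast
  let ?P = "\<lambda>W. W \<subseteq> pts A \<and> (\<forall>c\<in>A. open (cmap c ` (W \<inter> cdom c)))"
  have "?P (V \<inter> W)" if "?P V" "?P W" for V W
    using that by (simp add: Int open_Int le_infI1)
  moreover have "?P (\<Union>\<K>)" if "\<forall>K\<in>\<K>. ?P K" for \<K>
  proof -
    have "\<Union>\<K> \<subseteq> pts A" using that by (simp add: Sup_le_iff)
    moreover have "open (cmap c ` (\<Union>\<K> \<inter> cdom c))" if "c \<in> A" for c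
      unfolding Un using \<open>\<forall>K\<in>\<K>. ?P K\<close> that by (intro open_UN) simp
    ultimately show ?thesis by simp
  qed
  ultimately have "istopology ?P"
    unfolding istopology_def by blast
  then show ?thesis
    by (simp add: manifold_topology_def)
qed

definition smooth_manifold :: "('q, 'e::euclidean_space) chart set \<Rightarrow> bool" where
  "smooth_manifold A \<longleftrightarrow> smooth_atlas A \<and> Hausdorff_space (manifold_topology A) \<and>
     (\<exists>\<B>. countable \<B> \<and> (\<forall>V\<in>\<B>. openin (manifold_topology A) V) \<and>
        (\<forall>W x. openin (manifold_topology A) W \<and> x \<in> W \<longrightarrow> (\<exists>V\<in>\<B>. x \<in> V \<and> V \<subseteq> W)))"

text \<open>Smoothness along an arbitrary subset \<open>S\<close>: local smooth extendability. For open \<open>S\<close>, and for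
  functions on embedded submanifolds \<open>S\<close>, this is the usual notion.\<close>

definition smooth_along ::
    "('q, 'e::euclidean_space) chart set \<Rightarrow> 'q set \<Rightarrow> ('q \<Rightarrow> 'f::real_normed_vector) \<Rightarrow> bool" where
  "smooth_along A S f \<longleftrightarrow>
     (\<forall>x\<in>S. \<exists>W g. openin (manifold_topology A) W \<and> x \<in> W \<and> (\<forall>y\<in>W \<inter> S. g y = f y) \<and>
        (\<forall>c\<in>A. smooth_on (cmap c ` (W \<inter> cdom c)) (g \<circ> cinv c)))"


subsection \<open>Tangent and cotangent vectors\<close>

text \<open>A tangent vector at \<open>x\<close> is the family of its coordinate representations in all charts around
  \<open>x\<close>, related by the Jacobians of the transition maps (and \<open>0\<close> at all other charts, which makes
  the representation unique).\<close>

type_synonym ('q, 'e) tvec = "('q, 'e) chart \<Rightarrow> 'e"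

definition tangent_space :: "('q, 'e::euclidean_space) chart set \<Rightarrow> 'q \<Rightarrow> ('q, 'e) tvec set" where
  "tangent_space A x = {v.
     (\<forall>c. \<not> (c \<in> A \<and> x \<in> cdom c) \<longrightarrow> v c = 0) \<and>
     (\<forall>c\<in>A. \<forall>d\<in>A. x \<in> cdom c \<inter> cdom d \<longrightarrow>
        v d = frechet_derivative (transition c d) (at (cmap c x)) (v c))}"

definition chart_at :: "('q, 'e) chart set \<Rightarrow> 'q \<Rightarrow> ('q, 'e) chart" where
  "chart_at A x = (SOME c. c \<in> A \<and> x \<in> cdom c)"

text \<open>The tangent vector at \<open>x\<close> with components \<open>e\<close> in the chart \<open>c\<close>; for basis vectors \<open>b\<close>, these
  are the coordinate vectors \<open>\<partial>/\<partial>q\<^sup>b\<close>.\<close>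

definition coord_vec ::
    "('q, 'e::euclidean_space) chart set \<Rightarrow> ('q, 'e) chart \<Rightarrow> 'q \<Rightarrow> 'e \<Rightarrow> ('q, 'e) tvec" where
  "coord_vec A c x e = (\<lambda>d. if d \<in> A \<and> x \<in> cdom d
     then frechet_derivative (transition c d) (at (cmap c x)) e else 0)"

definition linear_on_tangent ::
    "('q, 'e::euclidean_space) chart set \<Rightarrow> 'q \<Rightarrow> (('q, 'e) tvec \<Rightarrow> real) \<Rightarrow> bool" where
  "linear_on_tangent A x p \<longleftrightarrow>
     (\<forall>u\<in>tangent_space A x. \<forall>v\<in>tangent_space A x. \<forall>a b.
        p (\<lambda>c. a *\<^sub>R u c + b *\<^sub>R v c) = a * p u + b * p v)"

definition cotangent_space ::
    "('q, 'e::euclidean_space) chart set \<Rightarrow> 'q \<Rightarrow> (('q, 'e) tvec \<Rightarrow> real) set" where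
  "cotangent_space A x = {p. linear_on_tangent A x p \<and> (\<forall>v. v \<notin> tangent_space A x \<longrightarrow> p v = 0)}"

text \<open>The values of the following definitions do not depend on the choice of \<open>chart_at\<close>.\<close>

definition differential ::
    "('q, 'e::euclidean_space) chart set \<Rightarrow> ('q \<Rightarrow> real) \<Rightarrow> 'q \<Rightarrow> ('q, 'e) tvec \<Rightarrow> real" where
  "differential A f x v = (let c = chart_at A x in
     frechet_derivative (f \<circ> cinv c) (at (cmap c x)) (v c))"

definition tangent_map ::
    "('q, 'e::euclidean_space) chart set \<Rightarrow> ('r, 'f::euclidean_space) chart set \<Rightarrow>
     ('q \<Rightarrow> 'r) \<Rightarrow> 'q \<Rightarrow> ('q, 'e) tvec \<Rightarrow> ('r, 'f) tvec" where
  "tangent_map A B f x v = (\<lambda>d. if d \<in> B \<and> f x \<in> cdom d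
     then (let c = chart_at A x in
             frechet_derivative (cmap d \<circ> f \<circ> cinv c) (at (cmap c x)) (v c))
     else 0)"

text \<open>The Lie derivative of a function along a vector field.\<close>

definition lie_derivative ::
    "('q, 'e::euclidean_space) chart set \<Rightarrow> ('q \<Rightarrow> ('q, 'e) tvec) \<Rightarrow> ('q \<Rightarrow> real) \<Rightarrow> 'q \<Rightarrow> real" where
  "lie_derivative A X f x = differential A f x (X x)"

definition curve_velocity ::
    "('q, 'e::euclidean_space) chart set \<Rightarrow> (real \<Rightarrow> 'q) \<Rightarrow> real \<Rightarrow> ('q, 'e) tvec \<Rightarrow> bool" where
  "curve_velocity A \<gamma> t v \<longleftrightarrow> v \<in> tangent_space A (\<gamma> t) \<and>
     (\<forall>c\<in>A. \<gamma> t \<in> cdom c \<longrightarrow>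
        (\<forall>\<^sub>F s in nhds t. \<gamma> s \<in> cdom c) \<and>
        ((\<lambda>s. cmap c (\<gamma> s)) has_vector_derivative v c) (at t))"

definition smooth_curve ::
    "('q, 'e::euclidean_space) chart set \<Rightarrow> real set \<Rightarrow> (real \<Rightarrow> 'q) \<Rightarrow> bool" where
  "smooth_curve A J \<gamma> \<longleftrightarrow> \<gamma> ` J \<subseteq> pts A \<and>
     (\<forall>c\<in>A. open {t\<in>J. \<gamma> t \<in> cdom c} \<and> smooth_on {t\<in>J. \<gamma> t \<in> cdom c} (\<lambda>t. cmap c (\<gamma> t)))"

text \<open>The vectors at \<open>x\<close> tangent to \<open>N\<close>: velocities of smooth curves in \<open>N\<close>. This is the tangent
  space of \<open>N\<close> at \<open>x\<close> whenever \<open>N\<close> is an embedded submanifold.\<close>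

definition tangent_to ::
    "('q, 'e::euclidean_space) chart set \<Rightarrow> 'q set \<Rightarrow> 'q \<Rightarrow> ('q, 'e) tvec set" where
  "tangent_to A N x = {v. \<exists>\<epsilon>>0. \<exists>\<gamma>. smooth_curve A {-\<epsilon><..<\<epsilon>} \<gamma> \<and> \<gamma> ` {-\<epsilon><..<\<epsilon>} \<subseteq> N \<and>
     \<gamma> 0 = x \<and> curve_velocity A \<gamma> 0 v}"


subsection \<open>Vector fields, forms and metrics\<close>

definition smooth_vector_field ::
    "('q, 'e::euclidean_space) chart set \<Rightarrow> 'q set \<Rightarrow> ('q \<Rightarrow> ('q, 'e) tvec) \<Rightarrow> bool" where
  "smooth_vector_field A S X \<longleftrightarrow> (\<forall>x\<in>S. X x \<in> tangent_space A x) \<and>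
     (\<forall>c\<in>A. smooth_along A (S \<inter> cdom c) (\<lambda>x. X x c))"

definition smooth_one_form ::
    "('q, 'e::euclidean_space) chart set \<Rightarrow> 'q set \<Rightarrow> ('q \<Rightarrow> ('q, 'e) tvec \<Rightarrow> real) \<Rightarrow> bool" where
  "smooth_one_form A S \<eta> \<longleftrightarrow> (\<forall>x\<in>S. \<eta> x \<in> cotangent_space A x) \<and>
     (\<forall>c\<in>A. \<forall>b\<in>Basis. smooth_along A (S \<inter> cdom c) (\<lambda>x. \<eta> x (coord_vec A c x b)))"

definition smooth_bilinear_field ::
    "('q, 'e::euclidean_space) chart set \<Rightarrow> ('q \<Rightarrow> ('q, 'e) tvec \<Rightarrow> ('q, 'e) tvec \<Rightarrow> real) \<Rightarrow> bool" where
  "smooth_bilinear_field A \<beta> \<longleftrightarrow>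
     (\<forall>x\<in>pts A. \<forall>u\<in>tangent_space A x.
        linear_on_tangent A x (\<lambda>v. \<beta> x u v) \<and> linear_on_tangent A x (\<lambda>v. \<beta> x v u)) \<and>
     (\<forall>c\<in>A. \<forall>a\<in>Basis. \<forall>b\<in>Basis.
        smooth_along A (cdom c) (\<lambda>x. \<beta> x (coord_vec A c x a) (coord_vec A c x b)))"

definition two_form ::
    "('q, 'e::euclidean_space) chart set \<Rightarrow> ('q \<Rightarrow> ('q, 'e) tvec \<Rightarrow> ('q, 'e) tvec \<Rightarrow> real) \<Rightarrow> bool" where
  "two_form A \<beta> \<longleftrightarrow> smooth_bilinear_field A \<beta> \<and>
     (\<forall>x\<in>pts A. \<forall>u\<in>tangent_space A x. \<forall>v\<in>tangent_space A x. \<beta> x u v = - \<beta> x v u)"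

text \<open>Exterior derivative of a 2-form, evaluated in a chart on the constant extensions of the
  arguments:
  \<open>d\<beta>(u,v,w) = u(\<beta>(v,w)) - v(\<beta>(u,w)) + w(\<beta>(u,v))\<close>.\<close>

definition ext_deriv2 ::
    "('q, 'e::euclidean_space) chart set \<Rightarrow> ('q \<Rightarrow> ('q, 'e) tvec \<Rightarrow> ('q, 'e) tvec \<Rightarrow> real) \<Rightarrow>
     'q \<Rightarrow> ('q, 'e) tvec \<Rightarrow> ('q, 'e) tvec \<Rightarrow> ('q, 'e) tvec \<Rightarrow> real" where
  "ext_deriv2 A \<beta> x u v w = (let c = chart_at A x;
       D = (\<lambda>a b e. frechet_derivative
              (\<lambda>y. \<beta> (cinv c y) (coord_vec A c (cinv c y) a) (coord_vec A c (cinv c y) b))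
              (at (cmap c x)) e)
     in D (v c) (w c) (u c) - D (u c) (w c) (v c) + D (u c) (v c) (w c))"

definition closed_two_form ::
    "('q, 'e::euclidean_space) chart set \<Rightarrow> ('q \<Rightarrow> ('q, 'e) tvec \<Rightarrow> ('q, 'e) tvec \<Rightarrow> real) \<Rightarrow> bool" where
  "closed_two_form A \<beta> \<longleftrightarrow> two_form A \<beta> \<and>
     (\<forall>x\<in>pts A. \<forall>u\<in>tangent_space A x. \<forall>v\<in>tangent_space A x. \<forall>w\<in>tangent_space A x.
        ext_deriv2 A \<beta> x u v w = 0)"

definition riemannian_metric ::
    "('q, 'e::euclidean_space) chart set \<Rightarrow> ('q \<Rightarrow> ('q, 'e) tvec \<Rightarrow> ('q, 'e) tvec \<Rightarrow> real) \<Rightarrow> bool" where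
  "riemannian_metric A g \<longleftrightarrow> smooth_bilinear_field A g \<and>
     (\<forall>x\<in>pts A. \<forall>u\<in>tangent_space A x.
        (\<forall>v\<in>tangent_space A x. g x u v = g x v u) \<and> (u \<noteq> (\<lambda>_. 0) \<longrightarrow> g x u u > 0))"

definition sharp ::
    "('q, 'e::euclidean_space) chart set \<Rightarrow> ('q \<Rightarrow> ('q, 'e) tvec \<Rightarrow> ('q, 'e) tvec \<Rightarrow> real) \<Rightarrow>
     'q \<Rightarrow> (('q, 'e) tvec \<Rightarrow> real) \<Rightarrow> ('q, 'e) tvec" where
  "sharp A g x p = (THE v. v \<in> tangent_space A x \<and> (\<forall>w\<in>tangent_space A x. g x v w = p w))"


subsection \<open>Distributions\<close>

text \<open>A smooth distribution of rank \<open>r\<close>: locally the span of \<open>r\<close> pointwise linearly independent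
  smooth vector fields.\<close>

definition distribution ::
    "('q, 'e::euclidean_space) chart set \<Rightarrow> nat \<Rightarrow> ('q \<Rightarrow> ('q, 'e) tvec set) \<Rightarrow> bool" where
  "distribution A r D \<longleftrightarrow>
     (\<forall>x\<in>pts A. \<exists>W Y. openin (manifold_topology A) W \<and> x \<in> W \<and>
        (\<forall>i\<in>{1..r}. smooth_vector_field A W (Y i)) \<and>
        (\<forall>y\<in>W.
           (\<forall>a. (\<forall>c. (\<Sum>i=1..r. a i *\<^sub>R Y i y c) = 0) \<longrightarrow> (\<forall>i\<in>{1..r}. a i = (0::real))) \<and>
           D y = {v. \<exists>a. v = (\<lambda>c. \<Sum>i=1..r. a i *\<^sub>R Y i y c)}))"

definition embedded_submanifold :: "('q, 'e::euclidean_space) chart set \<Rightarrow> 'q set \<Rightarrow> bool" where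
  "embedded_submanifold A N \<longleftrightarrow> N \<subseteq> pts A \<and>
     (\<forall>x\<in>N. \<exists>c S. is_chart c \<and> cdom c \<subseteq> pts A \<and> (\<forall>d\<in>A. compatible c d \<and> compatible d c) \<and>
        x \<in> cdom c \<and> subspace S \<and> cmap c ` (N \<inter> cdom c) = cmap c ` cdom c \<inter> S)"

definition integral_manifold ::
    "('q, 'e::euclidean_space) chart set \<Rightarrow> ('q \<Rightarrow> ('q, 'e) tvec set) \<Rightarrow> 'q set \<Rightarrow> bool" where
  "integral_manifold A D N \<longleftrightarrow> embedded_submanifold A N \<and> (\<forall>x\<in>N. tangent_to A N x = D x)"

definition integrable_distribution ::
    "('q, 'e::euclidean_space) chart set \<Rightarrow> ('q \<Rightarrow> ('q, 'e) tvec set) \<Rightarrow> bool" where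
  "integrable_distribution A D \<longleftrightarrow> (\<forall>x\<in>pts A. \<exists>N. x \<in> N \<and> integral_manifold A D N)"

definition annihilator ::
    "('q, 'e::euclidean_space) chart set \<Rightarrow> ('q \<Rightarrow> ('q, 'e) tvec set) \<Rightarrow> 'q \<Rightarrow>
     (('q, 'e) tvec \<Rightarrow> real) set" where
  "annihilator A D x = {p \<in> cotangent_space A x. \<forall>v\<in>D x. p v = 0}"

definition local_annihilating_forms ::
    "('q, 'e::euclidean_space) chart set \<Rightarrow> ('q \<Rightarrow> ('q, 'e) tvec set) \<Rightarrow> nat \<Rightarrow> 'q set \<Rightarrow>
     (nat \<Rightarrow> 'q \<Rightarrow> ('q, 'e) tvec \<Rightarrow> real) \<Rightarrow> bool" where
  "local_annihilating_forms A D k U \<eta> \<longleftrightarrow>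
     openin (manifold_topology A) U \<and> (\<forall>i\<in>{1..k}. smooth_one_form A U (\<eta> i)) \<and>
     (\<forall>x\<in>U. {p. \<exists>a. p = (\<lambda>v. \<Sum>i=1..k. a i * \<eta> i x v)} = annihilator A D x)"


subsection \<open>The cotangent bundle\<close>

text \<open>The points of \<open>T\<^sup>*Q\<close> are pairs \<open>(x, p)\<close> with \<open>p\<close> a covector at \<open>x\<close>, so that \<open>fst\<close> is the bundle
  projection; a chart \<open>q\<close> of \<open>Q\<close> induces the chart \<open>(q, p)\<close> where \<open>p\<^sub>b\<close> is the value of the covector
  on \<open>\<partial>/\<partial>q\<^sup>b\<close>.\<close>

type_synonym ('q, 'e) cotan = "'q \<times> (('q, 'e) tvec \<Rightarrow> real)"

definition lift_chart ::
    "('q, 'e::euclidean_space) chart set \<Rightarrow> ('q, 'e) chart \<Rightarrow> (('q, 'e) cotan, 'e \<times> 'e) chart" where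
  "lift_chart A c = Chart {(x, p). x \<in> cdom c \<and> p \<in> cotangent_space A x}
     (\<lambda>(x, p). (cmap c x, \<Sum>b\<in>Basis. p (coord_vec A c x b) *\<^sub>R b))"

definition cotangent_bundle ::
    "('q, 'e::euclidean_space) chart set \<Rightarrow> (('q, 'e) cotan, 'e \<times> 'e) chart set" where
  "cotangent_bundle A = lift_chart A ` A"

text \<open>\<open>\<omega> = dq\<^sup>i \<and> dp\<^sub>i\<close>, with the convention \<open>(\<alpha> \<and> \<beta>)(v, w) = \<alpha>(v) \<beta>(w) - \<alpha>(w) \<beta>(v)\<close>.\<close>

definition canonical_symplectic_form ::
    "('q, 'e::euclidean_space) chart set \<Rightarrow> ('q, 'e) cotan \<Rightarrow>
     (('q, 'e) cotan, 'e \<times> 'e) tvec \<Rightarrow> (('q, 'e) cotan, 'e \<times> 'e) tvec \<Rightarrow> real" where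
  "canonical_symplectic_form A \<alpha> v w = (let c = chart_at (cotangent_bundle A) \<alpha> in
     \<Sum>b\<in>Basis. (fst (v c) \<bullet> b) * (snd (w c) \<bullet> b) - (fst (w c) \<bullet> b) * (snd (v c) \<bullet> b))"

abbreviation proj_tangent ::
    "('q, 'e::euclidean_space) chart set \<Rightarrow> ('q, 'e) cotan \<Rightarrow>
     (('q, 'e) cotan, 'e \<times> 'e) tvec \<Rightarrow> ('q, 'e) tvec" where
  "proj_tangent A \<equiv> tangent_map (cotangent_bundle A) A fst"

definition pullback1 ::
    "('q, 'e::euclidean_space) chart set \<Rightarrow> ('q \<Rightarrow> ('q, 'e) tvec \<Rightarrow> real) \<Rightarrow>
     ('q, 'e) cotan \<Rightarrow> (('q, 'e) cotan, 'e \<times> 'e) tvec \<Rightarrow> real" where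
  "pullback1 A \<eta> \<alpha> v = \<eta> (fst \<alpha>) (proj_tangent A \<alpha> v)"

definition pullback2 ::
    "('q, 'e::euclidean_space) chart set \<Rightarrow> ('q \<Rightarrow> ('q, 'e) tvec \<Rightarrow> ('q, 'e) tvec \<Rightarrow> real) \<Rightarrow>
     ('q, 'e) cotan \<Rightarrow> (('q, 'e) cotan, 'e \<times> 'e) tvec \<Rightarrow> (('q, 'e) cotan, 'e \<times> 'e) tvec \<Rightarrow> real" where
  "pullback2 A \<beta> \<alpha> v w = \<beta> (fst \<alpha>) (proj_tangent A \<alpha> v) (proj_tangent A \<alpha> w)"

definition magnetic_form ::
    "('q, 'e::euclidean_space) chart set \<Rightarrow> ('q \<Rightarrow> ('q, 'e) tvec \<Rightarrow> ('q, 'e) tvec \<Rightarrow> real) \<Rightarrow>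
     ('q, 'e) cotan \<Rightarrow> (('q, 'e) cotan, 'e \<times> 'e) tvec \<Rightarrow> (('q, 'e) cotan, 'e \<times> 'e) tvec \<Rightarrow> real" where
  "magnetic_form A \<B> \<alpha> v w = canonical_symplectic_form A \<alpha> v w + pullback2 A \<B> \<alpha> v w"


subsection \<open>Hamiltonian mechanics with nonholonomic constraints\<close>

text \<open>Kinetic energy of the dual metric plus potential energy.\<close>

definition natural_hamiltonian ::
    "('q, 'e::euclidean_space) chart set \<Rightarrow> (('q, 'e) cotan \<Rightarrow> real) \<Rightarrow> bool" where
  "natural_hamiltonian A H \<longleftrightarrow> (\<exists>g V. riemannian_metric A g \<and> smooth_along A (pts A) V \<and>
     (\<forall>x\<in>pts A. \<forall>p\<in>cotangent_space A x.
        H (x, p) = 1/2 * g x (sharp A g x p) (sharp A g x p) + V x))"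

text \<open>The fiber derivative at \<open>(x, p)\<close> is the derivative of \<open>H\<close> along the fiber, an element of the
  bidual of the tangent space, identified with a tangent vector.\<close>

definition fiber_derivative ::
    "('q, 'e::euclidean_space) chart set \<Rightarrow> (('q, 'e) cotan \<Rightarrow> real) \<Rightarrow> ('q, 'e) cotan \<Rightarrow> ('q, 'e) tvec" where
  "fiber_derivative A H \<alpha> = (THE v. v \<in> tangent_space A (fst \<alpha>) \<and>
     (\<forall>\<beta>\<in>cotangent_space A (fst \<alpha>).
        ((\<lambda>s. H (fst \<alpha>, \<lambda>u. snd \<alpha> u + s * \<beta> u)) has_real_derivative \<beta> v) (at 0)))"

definition co_distribution ::
    "('q, 'e::euclidean_space) chart set \<Rightarrow> (('q, 'e) cotan \<Rightarrow> real) \<Rightarrow> ('q \<Rightarrow> ('q, 'e) tvec set) \<Rightarrow>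
     ('q, 'e) cotan set" where
  "co_distribution A H D = {\<alpha> \<in> pts (cotangent_bundle A). fiber_derivative A H \<alpha> \<in> D (fst \<alpha>)}"

text \<open>\<open>X\<close> is a smooth vector field on the submanifold \<open>N\<close>.\<close>

definition vector_field_on_submanifold ::
    "('q, 'e::euclidean_space) chart set \<Rightarrow> 'q set \<Rightarrow> ('q \<Rightarrow> ('q, 'e) tvec) \<Rightarrow> bool" where
  "vector_field_on_submanifold A N X \<longleftrightarrow>
     smooth_vector_field A N X \<and> (\<forall>x\<in>N. X x \<in> tangent_to A N x)"

definition integral_curve ::
    "('q, 'e::euclidean_space) chart set \<Rightarrow> 'q set \<Rightarrow> ('q \<Rightarrow> ('q, 'e) tvec) \<Rightarrow> real set \<Rightarrow>
     (real \<Rightarrow> 'q) \<Rightarrow> bool" where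
  "integral_curve A N X J \<gamma> \<longleftrightarrow> open J \<and> is_interval J \<and>
     (\<forall>t\<in>J. \<gamma> t \<in> N \<and> curve_velocity A \<gamma> t (X (\<gamma> t)))"

definition preserved_by_flow ::
    "('q, 'e::euclidean_space) chart set \<Rightarrow> 'q set \<Rightarrow> ('q \<Rightarrow> ('q, 'e) tvec) \<Rightarrow> ('q \<Rightarrow> real) \<Rightarrow> bool" where
  "preserved_by_flow A N X f \<longleftrightarrow>
     (\<forall>J \<gamma>. integral_curve A N X J \<gamma> \<longrightarrow> (\<forall>s\<in>J. \<forall>t\<in>J. f (\<gamma> s) = f (\<gamma> t)))"

end

theory Submission
  imports Defs
begin

text \<open>Energy is conserved because neither the magnetic term nor the reaction forces do work. Inserting
  \<open>X\<close> into its own defining equation gives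
  \<open>0 = \<omega>\<^sub>\<B>(X, X) = dH(X) + \<lambda>\<^sup>i \<eta>\<^sub>i(\<pi>\<^sub>* X)\<close>, the left-hand side being zero since \<open>\<omega>\<^sub>\<B>\<close> is alternating
  (\<open>magnetic_form_self\<close>). So \<open>dH(X) = 0\<close> as soon as \<open>\<pi>\<^sub>* X\<close> lies in the distribution.

  Being a vector at a point of the co-distribution does not by itself say where \<open>\<pi>\<^sub>* X\<close> lies; the
  equation does. Inserting vertical vectors kills every term pulled back from the base and leaves
  \<open>dq\<^sup>b/dt = \<partial>H/\<partial>p\<^sub>b\<close>, that is, \<open>\<pi>\<^sub>* X\<close> is the fiber derivative of \<open>H\<close>
  (\<open>proj_magnetic_hamiltonian_vector\<close>), and the co-distribution is by definition the set of covectors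
  whose fiber derivative satisfies the constraints.

  To insert vertical vectors one must know that there are enough of them: a coordinate vector of the
  cotangent bundle has to be compatible with all charts, which is the chain rule for the lifted
  transition maps (\<open>coord_vec_in_tangent_space\<close>, \<open>differentiable_atlas_cotangent_bundle\<close>).
  Constancy along integral curves then follows from the vanishing derivative
  (\<open>preserved_by_flow_if_lie_derivative_zero\<close>).\<close>

section \<open>Atlases with differentiable transition maps\<close>

text \<open>One derivative of the transition maps is all that the transformation rule of tangent vectors
  involves. For the cotangent bundle it is also cheap to establish, as the lifted transition maps are
  explicit in terms of first derivatives of those of the base.\<close>

definition differentiable_atlas :: "('q, 'e::euclidean_space) chart set \<Rightarrow> bool" where
  "differentiable_atlas A \<longleftrightarrow>
     (\<forall>c\<in>A. inj_on (cmap c) (cdom c)) \<and>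
     (\<forall>c\<in>A. \<forall>d\<in>A. open (cmap c ` (cdom c \<inter> cdom d)) \<and>
        (\<forall>x\<in>cdom c \<inter> cdom d. transition c d differentiable (at (cmap c x))))"

lemma differentiable_atlasD:
  assumes "differentiable_atlas A" "c \<in> A"
  shows differentiable_atlas_inj: "inj_on (cmap c) (cdom c)"
    and differentiable_atlas_open: "d \<in> A \<Longrightarrow> open (cmap c ` (cdom c \<inter> cdom d))"
    and differentiable_atlas_transition:
      "d \<in> A \<Longrightarrow> x \<in> cdom c \<Longrightarrow> x \<in> cdom d \<Longrightarrow> transition c d differentiable (at (cmap c x))"
  using assms by (auto simp: differentiable_atlas_def)

lemma smooth_on_imp_differentiable:
  assumes "smooth_on S f" "x \<in> S"
  shows "f differentiable (at x)"
proof -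
  have "Ck_on (Suc 0) S f" using assms(1) by (simp only: smooth_on_def)
  then show ?thesis using assms(2) by simp
qed

lemma smooth_on_imp_frechet_derivative_differentiable:
  assumes "smooth_on S f" "x \<in> S"
  shows "(\<lambda>y. frechet_derivative f (at y) v) differentiable (at x)"
proof -
  have "Ck_on (Suc (Suc 0)) S f" using assms(1) by (simp only: smooth_on_def)
  then show ?thesis using assms(2) by simp
qed

lemma smooth_imp_differentiable_atlas:
  assumes "smooth_atlas A"
  shows "differentiable_atlas A"
  unfolding differentiable_atlas_def
proof (intro conjI ballI)
  fix c assume "c \<in> A"
  then show "inj_on (cmap c) (cdom c)"
    using assms by (simp add: smooth_atlas_def is_chart_def)
next
  fix c d assume "c \<in> A" "d \<in> A"
  then have comp: "compatible c d" using assms by (simp add: smooth_atlas_def)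
  then show "open (cmap c ` (cdom c \<inter> cdom d))" by (simp add: compatible_def)
  fix x assume "x \<in> cdom c \<inter> cdom d"
  then show "transition c d differentiable (at (cmap c x))"
    using comp unfolding compatible_def by (blast intro: smooth_on_imp_differentiable)
qed

lemma cinv_cmap:
  "inj_on (cmap c) (cdom c) \<Longrightarrow> x \<in> cdom c \<Longrightarrow> cinv c (cmap c x) = x"
  by (simp add: cinv_def)

lemma chart_at:
  assumes "x \<in> pts A"
  shows "chart_at A x \<in> A" "x \<in> cdom (chart_at A x)"
proof -
  have "\<exists>c. c \<in> A \<and> x \<in> cdom c" using assms by (auto simp: pts_def)
  then have "chart_at A x \<in> A \<and> x \<in> cdom (chart_at A x)"
    unfolding chart_at_def by (rule someI_ex)
  then show "chart_at A x \<in> A" "x \<in> cdom (chart_at A x)" by auto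
qed

lemma tangent_spaceD:
  assumes "v \<in> tangent_space A x"
  shows "\<not> (c \<in> A \<and> x \<in> cdom c) \<Longrightarrow> v c = 0"
    and "c \<in> A \<Longrightarrow> d \<in> A \<Longrightarrow> x \<in> cdom c \<Longrightarrow> x \<in> cdom d \<Longrightarrow>
      v d = frechet_derivative (transition c d) (at (cmap c x)) (v c)"
  using assms unfolding tangent_space_def by blast+

lemma tangent_space_eq_coord_vec:
  assumes v: "v \<in> tangent_space A x" and c: "c \<in> A" "x \<in> cdom c"
  shows "v = coord_vec A c x (v c)"
proof
  fix d
  show "v d = coord_vec A c x (v c) d"
  proof (cases "d \<in> A \<and> x \<in> cdom d")
    case True
    then show ?thesis
      using tangent_spaceD(2)[OF v c(1) _ c(2), of d] by (simp only: coord_vec_def if_True conj_absorb simp_thms)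
  next
    case False
    then show ?thesis
      using tangent_spaceD(1)[OF v False] by (simp only: coord_vec_def if_False)
  qed
qed

lemma coord_vec_self:
  assumes A: "differentiable_atlas A" and c: "c \<in> A" "x \<in> cdom c"
  shows "coord_vec A c x e c = e"
proof -
  have "open (cmap c ` cdom c)"
    using differentiable_atlas_open[OF A c(1) c(1)] by simp
  then have "(transition c c has_derivative (\<lambda>h. h)) (at (cmap c x))"
    using c cinv_cmap[OF differentiable_atlas_inj[OF A c(1)]]
    by (intro has_derivative_transform_within_open[OF has_derivative_ident])
       (auto simp: transition_def)
  then have "(\<lambda>h. h) = frechet_derivative (transition c c) (at (cmap c x))"
    by (rule frechet_derivative_at)
  with c show ?thesis by (simp add: coord_vec_def fun_eq_iff)
qed

text \<open>The compatibility demanded of a tangent vector is the chain rule for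
  \<open>transition c e = transition d e \<circ> transition c d\<close>, which holds near \<open>cmap c x\<close>.\<close>

lemma coord_vec_in_tangent_space:
  assumes A: "differentiable_atlas A" and c: "c \<in> A" "x \<in> cdom c"
  shows "coord_vec A c x v \<in> tangent_space A x"
proof -
  have "coord_vec A c x v e =
          frechet_derivative (transition d e) (at (cmap d x)) (coord_vec A c x v d)"
    if d: "d \<in> A" "x \<in> cdom d" and e: "e \<in> A" "x \<in> cdom e" for d e
  proof -
    note inj = cinv_cmap[OF differentiable_atlas_inj[OF A]]
    let ?V = "cmap c ` (cdom c \<inter> cdom d) \<inter> cmap c ` (cdom c \<inter> cdom e)"
    have x: "transition c d (cmap c x) = cmap d x"
      using c inj by (simp add: transition_def)
    have "(transition c d has_derivative frechet_derivative (transition c d) (at (cmap c x)))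
            (at (cmap c x))"
      using differentiable_atlas_transition[OF A c(1) d(1) c(2) d(2)]
      by (simp add: frechet_derivative_works)
    moreover have "(transition d e has_derivative frechet_derivative (transition d e) (at (cmap d x)))
            (at (transition c d (cmap c x)))"
      using differentiable_atlas_transition[OF A d(1) e(1) d(2) e(2)]
      by (simp add: frechet_derivative_works x)
    ultimately have "(transition d e \<circ> transition c d has_derivative
        frechet_derivative (transition d e) (at (cmap d x)) \<circ>
        frechet_derivative (transition c d) (at (cmap c x))) (at (cmap c x))"
      by (rule diff_chain_at)
    moreover have "open ?V"
      using differentiable_atlas_open[OF A c(1)] d e by blast
    moreover have "cmap c x \<in> ?V" using c d e by blast
    moreover have "(transition d e \<circ> transition c d) y = transition c e y" if "y \<in> ?V" for y
    proof -
      from that obtain z w where zw: "y = cmap c z" "z \<in> cdom c" "z \<in> cdom d"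
        "y = cmap c w" "w \<in> cdom c" "w \<in> cdom e" by blast
      then have "w = z" using differentiable_atlas_inj[OF A c(1)] by (auto dest: inj_onD)
      with zw show ?thesis using c d inj by (simp add: transition_def)
    qed
    ultimately have "(transition c e has_derivative
        frechet_derivative (transition d e) (at (cmap d x)) \<circ>
        frechet_derivative (transition c d) (at (cmap c x))) (at (cmap c x))"
      by (rule has_derivative_transform_within_open)
    from frechet_derivative_at[OF this, symmetric] show ?thesis
      using d e by (simp add: coord_vec_def)
  qed
  moreover have "coord_vec A c x v d = 0" if "\<not> (d \<in> A \<and> x \<in> cdom d)" for d
    using that by (simp only: coord_vec_def if_False)
  ultimately show ?thesis unfolding tangent_space_def by blast
qed

lemma linear_coord_vec:
  assumes A: "differentiable_atlas A" and c: "c \<in> A" "x \<in> cdom c"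
  shows "linear (\<lambda>v. coord_vec A c x v d)"
proof (cases "d \<in> A \<and> x \<in> cdom d")
  case True
  with c have "linear (frechet_derivative (transition c d) (at (cmap c x)))"
    by (intro linear_frechet_derivative differentiable_atlas_transition[OF A]) auto
  with True show ?thesis by (simp add: coord_vec_def)
next
  case False
  then have "(\<lambda>v. coord_vec A c x v d) = (\<lambda>v. 0)" by (auto simp: coord_vec_def)
  then show ?thesis by (simp add: module_hom_zero)
qed

lemma linear_covector_coord_vec:
  assumes A: "differentiable_atlas A" and c: "c \<in> A" "x \<in> cdom c"
    and p: "linear_on_tangent A x p"
  shows "linear (\<lambda>v. p (coord_vec A c x v))"
proof -
  note lin = linear_coord_vec[OF A c]
  have comb: "p (coord_vec A c x (a *\<^sub>R u + b *\<^sub>R v)) =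
                a * p (coord_vec A c x u) + b * p (coord_vec A c x v)" for a b u v
  proof -
    have "coord_vec A c x (a *\<^sub>R u + b *\<^sub>R v) =
            (\<lambda>d. a *\<^sub>R coord_vec A c x u d + b *\<^sub>R coord_vec A c x v d)"
      by (simp add: fun_eq_iff linear_add[OF lin] linear_scale[OF lin])
    then show ?thesis
      using p coord_vec_in_tangent_space[OF A c] by (simp add: linear_on_tangent_def)
  qed
  show ?thesis
    using comb[of 1 _ 1] comb[of _ _ 0 0] by (intro linearI) auto
qed

lemma covector_coordinates:
  assumes A: "differentiable_atlas A" and c: "c \<in> A" "x \<in> cdom c"
    and p: "linear_on_tangent A x p"
  shows "p (coord_vec A c x v) = (\<Sum>b\<in>Basis. (v \<bullet> b) * p (coord_vec A c x b))"
proof -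
  note lin = linear_covector_coord_vec[OF A c p]
  have "p (coord_vec A c x v) = p (coord_vec A c x (\<Sum>b\<in>Basis. (v \<bullet> b) *\<^sub>R b))"
    by (simp only: euclidean_representation)
  also have "\<dots> = (\<Sum>b\<in>Basis. p (coord_vec A c x ((v \<bullet> b) *\<^sub>R b)))"
    by (rule linear_sum[OF lin])
  also have "\<dots> = (\<Sum>b\<in>Basis. (v \<bullet> b) * p (coord_vec A c x b))"
    by (simp add: linear_scale[OF lin])
  finally show ?thesis .
qed

lemma linear_on_tangent_zero:
  assumes "linear_on_tangent A x p" "differentiable_atlas A" "c \<in> A" "x \<in> cdom c"
  shows "p (coord_vec A c x 0) = 0"
  using linear_0[OF linear_covector_coord_vec[OF assms(2,3,4,1)]] .

lemma tangent_space_lincomb: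
  assumes A: "differentiable_atlas A" and c: "c \<in> A" "x \<in> cdom c"
    and "u \<in> tangent_space A x" "v \<in> tangent_space A x"
  shows "(\<lambda>d. r *\<^sub>R u d + s *\<^sub>R v d) \<in> tangent_space A x"
proof -
  have "(\<lambda>d. r *\<^sub>R u d + s *\<^sub>R v d) = coord_vec A c x (r *\<^sub>R u c + s *\<^sub>R v c)"
  proof
    fix d
    have "coord_vec A c x (r *\<^sub>R u c + s *\<^sub>R v c) d =
        r *\<^sub>R coord_vec A c x (u c) d + s *\<^sub>R coord_vec A c x (v c) d"
      by (simp only: linear_add[OF linear_coord_vec[OF A c]] linear_scale[OF linear_coord_vec[OF A c]])
    then show "r *\<^sub>R u d + s *\<^sub>R v d = coord_vec A c x (r *\<^sub>R u c + s *\<^sub>R v c) d"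
      by (simp only: fun_cong[OF tangent_space_eq_coord_vec[OF assms(4) c], symmetric]
          fun_cong[OF tangent_space_eq_coord_vec[OF assms(5) c], symmetric])
  qed
  then show ?thesis by (simp only: coord_vec_in_tangent_space[OF A c])
qed

text \<open>The covector at \<open>x\<close> with components \<open>e\<close> in the chart \<open>c\<close>, dual to \<open>coord_vec\<close>. The value \<open>0\<close> outside
  the tangent space is the normalisation that \<open>cotangent_space\<close> imposes.\<close>

definition covector :: "('q, 'e::euclidean_space) chart set \<Rightarrow> ('q, 'e) chart \<Rightarrow> 'q \<Rightarrow> 'e \<Rightarrow>
    ('q, 'e) tvec \<Rightarrow> real" where
  "covector A c x e = (\<lambda>v. if v \<in> tangent_space A x then v c \<bullet> e else 0)"

lemma covector_in_cotangent_space: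
  assumes A: "differentiable_atlas A" and c: "c \<in> A" "x \<in> cdom c"
  shows "covector A c x e \<in> cotangent_space A x"
  unfolding cotangent_space_def linear_on_tangent_def covector_def
  by (simp add: tangent_space_lincomb[OF A c] inner_add_left)

text \<open>Covectors separate tangent vectors: the coordinate covectors of a chart already do.\<close>

lemma tangent_vector_eqI:
  assumes A: "differentiable_atlas A" and c: "c \<in> A" "x \<in> cdom c"
    and v: "v \<in> tangent_space A x" and w: "w \<in> tangent_space A x"
    and eq: "\<And>p. p \<in> cotangent_space A x \<Longrightarrow> p v = p w"
  shows "v = w"
proof -
  have "v c \<bullet> b = w c \<bullet> b" for b
  proof -
    have "covector A c x b v = covector A c x b w"
      by (rule eq[OF covector_in_cotangent_space[OF A c]])
    then show ?thesis using v w by (simp add: covector_def)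
  qed
  then have "v c = w c" by (rule euclidean_eqI)
  then have "coord_vec A c x (v c) = coord_vec A c x (w c)" by simp
  then show ?thesis
    by (simp only: tangent_space_eq_coord_vec[OF v c, symmetric]
        tangent_space_eq_coord_vec[OF w c, symmetric])
qed

text \<open>A local extension of \<open>f\<close> agrees with \<open>f\<close> on a whole neighbourhood, so it has the same derivative
  in every chart.\<close>

lemma smooth_along_pts_differentiable:
  assumes A: "differentiable_atlas A" and f: "smooth_along A (pts A) f"
    and c: "c \<in> A" "x \<in> cdom c"
  shows "(f \<circ> cinv c) differentiable (at (cmap c x))"
proof -
  note inj = differentiable_atlas_inj[OF A]
  have "x \<in> pts A" using c by (auto simp: pts_def)
  with f obtain W g where W: "openin (manifold_topology A) W" "x \<in> W"
    and eq: "\<forall>y\<in>W \<inter> pts A. g y = f y"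
    and g: "\<forall>c\<in>A. smooth_on (cmap c ` (W \<inter> cdom c)) (g \<circ> cinv c)"
    unfolding smooth_along_def by blast
  have op: "open (cmap c ` (W \<inter> cdom c))"
    using W(1) c(1) by (simp add: openin_manifold_topology[OF inj])
  have x: "cmap c x \<in> cmap c ` (W \<inter> cdom c)" using W c by blast
  have ext: "(g \<circ> cinv c) y = (f \<circ> cinv c) y" if "y \<in> cmap c ` (W \<inter> cdom c)" for y
    using that eq c cinv_cmap[OF inj[OF c(1)]] by (auto simp: pts_def)
  obtain g' where "(g \<circ> cinv c has_derivative g') (at (cmap c x))"
    using smooth_on_imp_differentiable[OF bspec[OF g c(1)] x] by (auto simp: differentiable_def)
  then have "(f \<circ> cinv c has_derivative g') (at (cmap c x))"
    by (rule has_derivative_transform_within_open[OF _ op x ext])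
  then show ?thesis by (auto simp: differentiable_def)
qed

section \<open>The cotangent bundle\<close>

lemma cdom_lift_chart: "(x, p) \<in> cdom (lift_chart A c) \<longleftrightarrow> x \<in> cdom c \<and> p \<in> cotangent_space A x"
  by (simp add: lift_chart_def)

lemma cmap_lift_chart:
  "cmap (lift_chart A c) (x, p) = (cmap c x, \<Sum>b\<in>Basis. p (coord_vec A c x b) *\<^sub>R b)"
  by (simp add: lift_chart_def)

lemma cmap_lift_chart_covector:
  assumes A: "differentiable_atlas A" and c: "c \<in> A" "x \<in> cdom c"
  shows "cmap (lift_chart A c) (x, covector A c x e) = (cmap c x, e)"
  by (simp add: cmap_lift_chart covector_def coord_vec_in_tangent_space[OF A c]
      coord_vec_self[OF A c] inner_commute[of _ e] euclidean_representation)

lemma covector_cmap_lift_chart: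
  assumes A: "differentiable_atlas A" and c: "c \<in> A" "x \<in> cdom c"
    and p: "p \<in> cotangent_space A x"
  shows "covector A c x (snd (cmap (lift_chart A c) (x, p))) = p"
proof
  fix v
  show "covector A c x (snd (cmap (lift_chart A c) (x, p))) v = p v"
  proof (cases "v \<in> tangent_space A x")
    case True
    have "p v = p (coord_vec A c x (v c))"
      by (rule arg_cong[OF tangent_space_eq_coord_vec[OF True c]])
    also have "\<dots> = (\<Sum>b\<in>Basis. (v c \<bullet> b) * p (coord_vec A c x b))"
      using p by (intro covector_coordinates[OF A c]) (simp add: cotangent_space_def)
    finally show ?thesis
      using True by (simp add: covector_def cmap_lift_chart inner_sum_right mult.commute)
  next
    case False
    with p show ?thesis by (simp add: covector_def cotangent_space_def)
  qed
qed

lemma inj_on_lift_chart: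
  assumes A: "differentiable_atlas A" and c: "c \<in> A"
  shows "inj_on (cmap (lift_chart A c)) (cdom (lift_chart A c))"
proof (rule inj_onI, clarify)
  fix x p y q
  assume xp: "(x, p) \<in> cdom (lift_chart A c)" and yq: "(y, q) \<in> cdom (lift_chart A c)"
    and eq: "cmap (lift_chart A c) (x, p) = cmap (lift_chart A c) (y, q)"
  have x: "x \<in> cdom c" "p \<in> cotangent_space A x" and y: "y \<in> cdom c" "q \<in> cotangent_space A y"
    using xp yq by (simp_all add: cdom_lift_chart)
  from eq have "cmap c x = cmap c y" by (simp add: cmap_lift_chart)
  then have "x = y" using x y by (intro inj_onD[OF differentiable_atlas_inj[OF A c]])
  moreover from this have "p = q"
    using trans[OF covector_cmap_lift_chart[OF A c x, symmetric]] eq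
      covector_cmap_lift_chart[OF A c y] by metis
  ultimately show "x = y \<and> p = q" ..
qed

text \<open>The lifted chart is onto the full fiber direction; this makes the images of overlaps open.\<close>

lemma image_lift_chart:
  assumes A: "differentiable_atlas A" and c: "c \<in> A" and V: "V \<subseteq> cdom c"
  shows "cmap (lift_chart A c) ` {(x, p). x \<in> V \<and> p \<in> cotangent_space A x} = cmap c ` V \<times> UNIV"
proof
  show "cmap (lift_chart A c) ` {(x, p). x \<in> V \<and> p \<in> cotangent_space A x} \<subseteq> cmap c ` V \<times> UNIV"
    by (auto simp: cmap_lift_chart)
next
  show "cmap c ` V \<times> UNIV \<subseteq> cmap (lift_chart A c) ` {(x, p). x \<in> V \<and> p \<in> cotangent_space A x}"
  proof clarify
    fix x e assume x: "x \<in> V"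
    with V have xc: "x \<in> cdom c" by blast
    show "(cmap c x, e) \<in> cmap (lift_chart A c) ` {(x, p). x \<in> V \<and> p \<in> cotangent_space A x}"
    proof (rule image_eqI[where x = "(x, covector A c x e)"])
      show "(cmap c x, e) = cmap (lift_chart A c) (x, covector A c x e)"
        by (simp only: cmap_lift_chart_covector[OF A c xc])
      show "(x, covector A c x e) \<in> {(x, p). x \<in> V \<and> p \<in> cotangent_space A x}"
        using x covector_in_cotangent_space[OF A c xc] by simp
    qed
  qed
qed

lemma cinv_lift_chart:
  assumes A: "differentiable_atlas A" and c: "c \<in> A" "x \<in> cdom c"
  shows "cinv (lift_chart A c) (cmap c x, e) = (x, covector A c x e)"
proof -
  have "(x, covector A c x e) \<in> cdom (lift_chart A c)"
    using c covector_in_cotangent_space[OF A c] by (simp add: cdom_lift_chart)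
  from cinv_cmap[OF inj_on_lift_chart[OF A c(1)] this] show ?thesis
    by (simp only: cmap_lift_chart_covector[OF A c])
qed

text \<open>On covector components a change of charts acts by the transposed Jacobian of the inverse change
  of charts.\<close>

lemma transition_lift_chart:
  assumes A: "differentiable_atlas A" and c: "c \<in> A" and d: "d \<in> A"
    and y: "y \<in> cmap c ` (cdom c \<inter> cdom d)"
  shows "transition (lift_chart A c) (lift_chart A d) (y, e) =
    (transition c d y,
     \<Sum>b\<in>Basis. (frechet_derivative (transition d c) (at (transition c d y)) b \<bullet> e) *\<^sub>R b)"
proof -
  from y obtain x where x: "y = cmap c x" "x \<in> cdom c" "x \<in> cdom d" by blast
  have "transition c d y = cmap d x"
    using x cinv_cmap[OF differentiable_atlas_inj[OF A c]] by (simp add: transition_def)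
  moreover have "covector A c x e (coord_vec A d x b) =
      frechet_derivative (transition d c) (at (cmap d x)) b \<bullet> e" for b
    using coord_vec_in_tangent_space[OF A d x(3)] c x by (simp add: covector_def coord_vec_def)
  ultimately show ?thesis
    by (simp add: transition_def[of "lift_chart A c"] x(1) cinv_lift_chart[OF A c x(2)]
        cmap_lift_chart)
qed

text \<open>A lifted transition map contains the Jacobian of a transition map of the base, so its derivative
  involves second derivatives on the base.\<close>

lemma differentiable_atlas_cotangent_bundle:
  assumes smooth: "smooth_atlas A"
  shows "differentiable_atlas (cotangent_bundle A)"
proof -
  have A: "differentiable_atlas A" by (rule smooth_imp_differentiable_atlas[OF smooth])
  have dom: "cdom (lift_chart A c) \<inter> cdom (lift_chart A d) =
      {(x, p). x \<in> cdom c \<inter> cdom d \<and> p \<in> cotangent_space A x}" for c d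
    by (auto simp: cdom_lift_chart)
  have img: "cmap (lift_chart A c) ` (cdom (lift_chart A c) \<inter> cdom (lift_chart A d)) =
      cmap c ` (cdom c \<inter> cdom d) \<times> UNIV" if "c \<in> A" for c d
    unfolding dom by (rule image_lift_chart[OF A that]) auto
  have op: "open (cmap c ` (cdom c \<inter> cdom d) \<times> (UNIV :: 'b set))" if "c \<in> A" "d \<in> A" for c d
    by (intro open_Times differentiable_atlas_open[OF A] that open_UNIV)
  have diff: "transition (lift_chart A c) (lift_chart A d) differentiable (at z)"
    if cd: "c \<in> A" "d \<in> A" and z: "z \<in> cmap c ` (cdom c \<inter> cdom d) \<times> UNIV" for c d z
  proof -
    from z obtain x e where x: "z = (cmap c x, e)" "x \<in> cdom c" "x \<in> cdom d" by blast
    let ?F = "\<lambda>b y. frechet_derivative (transition d c) (at y) b"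
    let ?T = "\<lambda>z. (transition c d (fst z), \<Sum>b\<in>Basis. (?F b (transition c d (fst z)) \<bullet> snd z) *\<^sub>R b)"
    have tx: "transition c d (cmap c x) = cmap d x"
      using x cd cinv_cmap[OF differentiable_atlas_inj[OF A]] by (simp add: transition_def)
    have fst: "fst differentiable (at z)" and snd: "snd differentiable (at z)"
      by (auto simp: differentiable_def intro!: exI has_derivative_fst[OF has_derivative_ident]
          has_derivative_snd[OF has_derivative_ident])
    have "transition c d differentiable (at (fst z))"
      using x differentiable_atlas_transition[OF A cd x(2,3)] by simp
    from differentiable_chain_at[OF fst this]
    have t: "(\<lambda>z. transition c d (fst z)) differentiable (at z)" by (simp add: o_def)
    have "?F b differentiable (at (cmap d x))" for b
      using smooth cd x unfolding smooth_atlas_def compatible_def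
      by (intro smooth_on_imp_frechet_derivative_differentiable[of "cmap d ` (cdom d \<inter> cdom c)"]) auto
    then have "?F b differentiable (at (transition c d (fst z)))" for b
      using x tx by simp
    from differentiable_chain_at[OF t this]
    have F: "(\<lambda>z. ?F b (transition c d (fst z))) differentiable (at z)" for b by (simp add: o_def)
    have "?T differentiable (at z)"
      by (rule differentiable_Pair[OF t], rule differentiable_sum[OF finite_Basis], rule ballI,
          rule differentiable_scaleR[OF differentiable_inner[OF F snd] differentiable_const])
    then obtain T' where T': "(?T has_derivative T') (at z)" by (auto simp only: differentiable_def)
    have "?T z = transition (lift_chart A c) (lift_chart A d) z"
      if "z \<in> cmap c ` (cdom c \<inter> cdom d) \<times> UNIV" for z
      using transition_lift_chart[OF A cd, of "fst z" "snd z"] that by (simp add: mem_Times_iff)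
    then have "(transition (lift_chart A c) (lift_chart A d) has_derivative T') (at z)"
      by (rule has_derivative_transform_within_open[OF T' op[OF cd] z])
    then show ?thesis unfolding differentiable_def by blast
  qed
  show ?thesis
    unfolding differentiable_atlas_def cotangent_bundle_def
  proof (intro conjI ballI; clarify)
    fix c assume "c \<in> A"
    then show "inj_on (cmap (lift_chart A c)) (cdom (lift_chart A c))"
      by (rule inj_on_lift_chart[OF A])
  next
    fix c d assume cd: "c \<in> A" "d \<in> A"
    then show "open (cmap (lift_chart A c) ` (cdom (lift_chart A c) \<inter> cdom (lift_chart A d)))"
      by (simp only: img op)
    fix x p
    assume "(x, p) \<in> cdom (lift_chart A c)" "(x, p) \<in> cdom (lift_chart A d)"
    then have "cmap (lift_chart A c) (x, p) \<in> cmap c ` (cdom c \<inter> cdom d) \<times> UNIV"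
      by (auto simp: cdom_lift_chart cmap_lift_chart)
    then show "transition (lift_chart A c) (lift_chart A d) differentiable
        (at (cmap (lift_chart A c) (x, p)))"
      by (rule diff[OF cd])
  qed
qed

text \<open>In bundle coordinates the projection is \<open>(q, p) \<mapsto> q\<close>, so its tangent map forgets the \<open>p\<close>-component.
  The chart is the one that \<open>chart_at\<close> selects, in which \<open>tangent_map\<close> is evaluated.\<close>

lemma proj_tangent_eq_coord_vec:
  assumes A: "differentiable_atlas A" and c: "c \<in> A" "chart_at (cotangent_bundle A) \<alpha> = lift_chart A c"
    and \<alpha>: "\<alpha> \<in> cdom (lift_chart A c)"
  shows "proj_tangent A \<alpha> w = coord_vec A c (fst \<alpha>) (fst (w (lift_chart A c)))"
proof
  fix d
  obtain x p where xp: "\<alpha> = (x, p)" by (cases \<alpha>)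
  with \<alpha> have x: "x \<in> cdom c" by (simp add: cdom_lift_chart)
  let ?C = "lift_chart A c"
  show "proj_tangent A \<alpha> w d = coord_vec A c (fst \<alpha>) (fst (w ?C)) d"
  proof (cases "d \<in> A \<and> x \<in> cdom d")
    case True
    let ?V = "cmap c ` (cdom c \<inter> cdom c) \<times> (UNIV :: 'b set)"
    have "(transition c d has_derivative frechet_derivative (transition c d) (at (cmap c x)))
        (at (fst (cmap ?C \<alpha>)))"
      using differentiable_atlas_transition[OF A c(1) _ x] True
      by (simp add: xp cmap_lift_chart frechet_derivative_works)
    from diff_chain_at[OF has_derivative_fst[OF has_derivative_ident] this]
    have "(transition c d \<circ> fst has_derivative
        frechet_derivative (transition c d) (at (cmap c x)) \<circ> fst) (at (cmap ?C \<alpha>))"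
      by (simp add: o_def)
    moreover have "open ?V"
      by (intro open_Times differentiable_atlas_open[OF A] c open_UNIV)
    moreover have "cmap ?C \<alpha> \<in> ?V" using x by (simp add: xp cmap_lift_chart)
    moreover have "(transition c d \<circ> fst) y = (cmap d \<circ> fst \<circ> cinv ?C) y" if "y \<in> ?V" for y
      using that cinv_lift_chart[OF A c(1)] cinv_cmap[OF differentiable_atlas_inj[OF A c(1)]]
      by (auto simp: transition_def)
    ultimately have "(cmap d \<circ> fst \<circ> cinv ?C has_derivative
        frechet_derivative (transition c d) (at (cmap c x)) \<circ> fst) (at (cmap ?C \<alpha>))"
      by (rule has_derivative_transform_within_open)
    from frechet_derivative_at[OF this, symmetric] show ?thesis
      using True by (simp add: tangent_map_def coord_vec_def c(2)[unfolded xp] xp)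
  next
    case False
    then show ?thesis by (auto simp: tangent_map_def coord_vec_def xp)
  qed
qed

lemma chart_at_cotangent_bundle:
  assumes "\<alpha> \<in> pts (cotangent_bundle A)"
  obtains c where "c \<in> A" "chart_at (cotangent_bundle A) \<alpha> = lift_chart A c"
    "\<alpha> \<in> cdom (lift_chart A c)"
  using chart_at[OF assms] by (auto simp: cotangent_bundle_def)

section \<open>The fiber derivative and the Hamiltonian equation\<close>

text \<open>The definite description in \<open>fiber_derivative\<close> is legitimate because derivatives are unique and
  covectors separate tangent vectors.\<close>

lemma fiber_derivative_eqI:
  assumes A: "differentiable_atlas A" and c: "c \<in> A" "fst \<alpha> \<in> cdom c"
    and v: "v \<in> tangent_space A (fst \<alpha>)"
    and deriv: "\<And>\<beta>. \<beta> \<in> cotangent_space A (fst \<alpha>) \<Longrightarrow>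
      ((\<lambda>s. H (fst \<alpha>, \<lambda>u. snd \<alpha> u + s * \<beta> u)) has_real_derivative \<beta> v) (at 0)"
  shows "fiber_derivative A H \<alpha> = v"
  unfolding fiber_derivative_def
proof (rule the_equality)
  show "v \<in> tangent_space A (fst \<alpha>) \<and> (\<forall>\<beta>\<in>cotangent_space A (fst \<alpha>).
      ((\<lambda>s. H (fst \<alpha>, \<lambda>u. snd \<alpha> u + s * \<beta> u)) has_real_derivative \<beta> v) (at 0))"
    using v deriv by blast
next
  fix w
  assume w: "w \<in> tangent_space A (fst \<alpha>) \<and> (\<forall>\<beta>\<in>cotangent_space A (fst \<alpha>).
      ((\<lambda>s. H (fst \<alpha>, \<lambda>u. snd \<alpha> u + s * \<beta> u)) has_real_derivative \<beta> w) (at 0))"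
  show "w = v"
    by (rule tangent_vector_eqI[OF A c conjunct1[OF w] v],
        rule DERIV_unique[OF bspec[OF conjunct2[OF w]] deriv])
qed

text \<open>A line in the fiber is a straight vertical line in the lifted chart.\<close>

lemma has_real_derivative_along_fiber:
  assumes A: "differentiable_atlas A" and c: "c \<in> A" "x \<in> cdom c"
    and p: "p \<in> cotangent_space A x" and \<beta>: "\<beta> \<in> cotangent_space A x"
    and H: "(H \<circ> cinv (lift_chart A c) has_derivative H') (at (cmap (lift_chart A c) (x, p)))"
  shows "((\<lambda>s. H (x, \<lambda>u. p u + s * \<beta> u)) has_real_derivative
    H' (0, \<Sum>b\<in>Basis. \<beta> (coord_vec A c x b) *\<^sub>R b)) (at 0)"
proof -
  let ?C = "lift_chart A c"
  let ?f = "\<Sum>b\<in>Basis. \<beta> (coord_vec A c x b) *\<^sub>R b"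
  let ?l = "\<lambda>s. (cmap c x, snd (cmap ?C (x, p)) + s *\<^sub>R ?f)"
  have l0: "?l 0 = cmap ?C (x, p)" by (simp add: cmap_lift_chart)
  have "(?l has_derivative (\<lambda>s. (0, s *\<^sub>R ?f))) (at 0)"
    by (auto intro!: derivative_eq_intros)
  moreover have "(H \<circ> cinv ?C has_derivative H') (at (?l 0))"
    using H by (simp only: l0)
  ultimately have "(H \<circ> cinv ?C \<circ> ?l has_derivative H' \<circ> (\<lambda>s. (0, s *\<^sub>R ?f))) (at 0)"
    by (rule diff_chain_at)
  moreover have "H \<circ> cinv ?C \<circ> ?l = (\<lambda>s. H (x, \<lambda>u. p u + s * \<beta> u))"
  proof
    fix s
    have "(\<lambda>u. p u + s * \<beta> u) \<in> cotangent_space A x"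
      using p \<beta> by (simp add: cotangent_space_def linear_on_tangent_def algebra_simps)
    then have dom: "(x, \<lambda>u. p u + s * \<beta> u) \<in> cdom ?C" using c by (simp add: cdom_lift_chart)
    have "cmap ?C (x, \<lambda>u. p u + s * \<beta> u) = ?l s"
      by (simp add: cmap_lift_chart scaleR_add_left sum.distrib scaleR_sum_right)
    then show "(H \<circ> cinv ?C \<circ> ?l) s = H (x, \<lambda>u. p u + s * \<beta> u)"
      using cinv_cmap[OF inj_on_lift_chart[OF A c(1)] dom] by (simp add: o_def)
  qed
  moreover have "H' \<circ> (\<lambda>s. (0, s *\<^sub>R ?f)) = (*) (H' (0, ?f))"
  proof
    fix s
    have "H' (s *\<^sub>R (0, ?f)) = s *\<^sub>R H' (0, ?f)"
      by (rule linear_scale[OF has_derivative_linear[OF H]])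
    then show "(H' \<circ> (\<lambda>s. (0, s *\<^sub>R ?f))) s = H' (0, ?f) * s" by (simp add: mult.commute)
  qed
  ultimately show ?thesis by (simp add: has_field_derivative_def)
qed

text \<open>Testing the equation on vertical vectors yields the first half of Hamilton's equations,
  \<open>dq\<^sup>b/dt = \<partial>H/\<partial>p\<^sub>b\<close>. Neither the magnetic term nor the reaction force \<open>\<theta>\<close> contributes, because
  both are pulled back from the base and so vanish on vertical vectors.\<close>

lemma proj_magnetic_hamiltonian_vector:
  assumes smooth: "smooth_atlas A"
    and H: "smooth_along (cotangent_bundle A) (pts (cotangent_bundle A)) H"
    and \<beta>: "two_form A \<beta>"
    and \<alpha>: "\<alpha> \<in> pts (cotangent_bundle A)"
    and \<theta>: "linear_on_tangent A (fst \<alpha>) \<theta>"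
    and eq: "\<And>w. w \<in> tangent_space (cotangent_bundle A) \<alpha> \<Longrightarrow>
      magnetic_form A \<beta> \<alpha> v w = differential (cotangent_bundle A) H \<alpha> w + \<theta> (proj_tangent A \<alpha> w)"
  shows "proj_tangent A \<alpha> v = fiber_derivative A H \<alpha>"
proof -
  have A: "differentiable_atlas A" by (rule smooth_imp_differentiable_atlas[OF smooth])
  have TA: "differentiable_atlas (cotangent_bundle A)"
    by (rule differentiable_atlas_cotangent_bundle[OF smooth])
  obtain c where c: "c \<in> A" and C: "chart_at (cotangent_bundle A) \<alpha> = lift_chart A c"
    and \<alpha>C: "\<alpha> \<in> cdom (lift_chart A c)"
    by (rule chart_at_cotangent_bundle[OF \<alpha>])
  let ?C = "lift_chart A c" and ?x = "fst \<alpha>" and ?p = "snd \<alpha>"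
  have CT: "?C \<in> cotangent_bundle A" using c by (simp add: cotangent_bundle_def)
  have x: "?x \<in> cdom c" and p: "?p \<in> cotangent_space A ?x"
    using \<alpha>C cdom_lift_chart[of ?x ?p A c] by simp_all
  note proj = proj_tangent_eq_coord_vec[OF A c C \<alpha>C]
  have projv: "proj_tangent A \<alpha> v \<in> tangent_space A ?x"
    unfolding proj by (rule coord_vec_in_tangent_space[OF A c x])
  obtain H' where H': "(H \<circ> cinv ?C has_derivative H') (at (cmap ?C \<alpha>))"
    using smooth_along_pts_differentiable[OF TA H CT \<alpha>C] by (auto simp: differentiable_def)
  have "fiber_derivative A H \<alpha> = proj_tangent A \<alpha> v"
  proof (rule fiber_derivative_eqI[OF A c x projv])
    fix \<gamma> assume \<gamma>: "\<gamma> \<in> cotangent_space A ?x"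
    \<comment> \<open>the vertical lift of \<open>\<gamma>\<close>\<close>
    let ?f = "\<Sum>b\<in>Basis. \<gamma> (coord_vec A c ?x b) *\<^sub>R b"
    let ?w = "coord_vec (cotangent_bundle A) ?C \<alpha> (0, ?f)"
    have w: "?w \<in> tangent_space (cotangent_bundle A) \<alpha>"
      by (rule coord_vec_in_tangent_space[OF TA CT \<alpha>C])
    have wC: "?w ?C = (0, ?f)" by (rule coord_vec_self[OF TA CT \<alpha>C])
    have projw: "proj_tangent A \<alpha> ?w = coord_vec A c ?x 0"
      by (simp only: proj wC fst_conv)
    have lin\<beta>: "linear_on_tangent A ?x (\<lambda>u. \<beta> ?x (proj_tangent A \<alpha> v) u)"
    proof -
      have "?x \<in> pts A" using c x by (auto simp: pts_def)
      with \<beta> projv show ?thesis by (simp add: two_form_def smooth_bilinear_field_def)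
    qed
    have "H' (0, ?f) = differential (cotangent_bundle A) H \<alpha> ?w"
      using frechet_derivative_at[OF H'] by (simp add: differential_def C wC Let_def)
    also have "\<dots> = magnetic_form A \<beta> \<alpha> v ?w"
      using eq[OF w] linear_on_tangent_zero[OF \<theta> A c x] by (simp only: projw)
    also have "\<dots> = canonical_symplectic_form A \<alpha> v ?w"
      using linear_on_tangent_zero[OF lin\<beta> A c x]
      by (simp only: magnetic_form_def pullback2_def projw)
    also have "\<dots> = (\<Sum>b\<in>Basis. (fst (v ?C) \<bullet> b) * \<gamma> (coord_vec A c ?x b))"
      by (simp add: canonical_symplectic_form_def C wC)
    also have "\<dots> = \<gamma> (proj_tangent A \<alpha> v)"
      unfolding proj using \<gamma>
      by (intro covector_coordinates[OF A c x, symmetric]) (simp add: cotangent_space_def)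
    finally have "H' (0, ?f) = \<gamma> (proj_tangent A \<alpha> v)" .
    moreover have "((\<lambda>s. H (?x, \<lambda>u. ?p u + s * \<gamma> u)) has_real_derivative H' (0, ?f)) (at 0)"
      using H' by (intro has_real_derivative_along_fiber[OF A c x p \<gamma>]) simp
    ultimately show "((\<lambda>s. H (?x, \<lambda>u. ?p u + s * \<gamma> u)) has_real_derivative
        \<gamma> (proj_tangent A \<alpha> v)) (at 0)" by simp
  qed
  then show ?thesis ..
qed

text \<open>The magnetic force does no work, being given by an alternating form.\<close>

lemma magnetic_form_self:
  assumes A: "differentiable_atlas A" and \<beta>: "two_form A \<beta>"
    and \<alpha>: "\<alpha> \<in> pts (cotangent_bundle A)"
  shows "magnetic_form A \<beta> \<alpha> v v = 0"
proof -
  obtain c where c: "c \<in> A" and C: "chart_at (cotangent_bundle A) \<alpha> = lift_chart A c"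
    and \<alpha>C: "\<alpha> \<in> cdom (lift_chart A c)"
    by (rule chart_at_cotangent_bundle[OF \<alpha>])
  have x: "fst \<alpha> \<in> cdom c"
    using \<alpha>C cdom_lift_chart[of "fst \<alpha>" "snd \<alpha>" A c] by simp
  have "proj_tangent A \<alpha> v \<in> tangent_space A (fst \<alpha>)"
    unfolding proj_tangent_eq_coord_vec[OF A c C \<alpha>C]
    by (rule coord_vec_in_tangent_space[OF A c x])
  moreover have "fst \<alpha> \<in> pts A" using c x by (auto simp: pts_def)
  ultimately have "\<beta> (fst \<alpha>) (proj_tangent A \<alpha> v) (proj_tangent A \<alpha> v) =
      - \<beta> (fst \<alpha>) (proj_tangent A \<alpha> v) (proj_tangent A \<alpha> v)"
    using \<beta> unfolding two_form_def by blast
  then show ?thesis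
    by (simp add: magnetic_form_def canonical_symplectic_form_def pullback2_def Let_def)
qed

section \<open>Conserved functions\<close>

text \<open>Along an integral curve the derivative of \<open>f\<close> is its Lie derivative, by the chain rule in a chart
  whose domain the curve does not leave for a short time.\<close>

lemma preserved_by_flow_if_lie_derivative_zero:
  assumes A: "differentiable_atlas A" and f: "smooth_along A (pts A) f"
    and N: "N \<subseteq> pts A" and zero: "\<And>x. x \<in> N \<Longrightarrow> lie_derivative A X f x = 0"
  shows "preserved_by_flow A N X f"
  unfolding preserved_by_flow_def
proof (intro allI impI ballI)
  fix J \<gamma> s t
  assume curve: "integral_curve A N X J \<gamma>" and s: "s \<in> J" and t: "t \<in> J"
  have "((\<lambda>s. f (\<gamma> s)) has_derivative (\<lambda>h. 0)) (at t within J)" if "t \<in> J" for t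
  proof -
    from curve that have \<gamma>t: "\<gamma> t \<in> N" and vel: "curve_velocity A \<gamma> t (X (\<gamma> t))"
      by (auto simp: integral_curve_def)
    let ?c = "chart_at A (\<gamma> t)"
    have c: "?c \<in> A" "\<gamma> t \<in> cdom ?c" using chart_at[of "\<gamma> t" A] \<gamma>t N by auto
    from vel c have ev: "\<forall>\<^sub>F s in nhds t. \<gamma> s \<in> cdom ?c"
      and deriv: "((\<lambda>s. cmap ?c (\<gamma> s)) has_vector_derivative X (\<gamma> t) ?c) (at t)"
      by (auto simp: curve_velocity_def)
    let ?f' = "frechet_derivative (f \<circ> cinv ?c) (at (cmap ?c (\<gamma> t)))"
    have f': "(f \<circ> cinv ?c has_derivative ?f') (at (cmap ?c (\<gamma> t)))"
      using smooth_along_pts_differentiable[OF A f c] by (simp only: frechet_derivative_works)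
    have "((f \<circ> cinv ?c) \<circ> (\<lambda>s. cmap ?c (\<gamma> s)) has_vector_derivative ?f' (X (\<gamma> t) ?c)) (at t)"
      by (rule vector_derivative_diff_chain_within[OF deriv has_derivative_at_withinI[OF f']])
    moreover have "?f' (X (\<gamma> t) ?c) = 0"
      using zero[OF \<gamma>t] by (simp add: lie_derivative_def differential_def Let_def)
    ultimately have d: "((f \<circ> cinv ?c) \<circ> (\<lambda>s. cmap ?c (\<gamma> s)) has_derivative (\<lambda>h. 0)) (at t)"
      by (simp add: has_vector_derivative_def)
    from ev obtain S where S: "open S" "t \<in> S" "\<And>s. s \<in> S \<Longrightarrow> \<gamma> s \<in> cdom ?c"
      by (auto simp: eventually_nhds)
    have "((f \<circ> cinv ?c) \<circ> (\<lambda>s. cmap ?c (\<gamma> s))) s = f (\<gamma> s)" if "s \<in> S" for s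
      using cinv_cmap[OF differentiable_atlas_inj[OF A c(1)] S(3)[OF that]] by simp
    then have "((\<lambda>s. f (\<gamma> s)) has_derivative (\<lambda>h. 0)) (at t)"
      by (rule has_derivative_transform_within_open[OF d S(1,2)])
    then show ?thesis by (rule has_derivative_at_withinI)
  qed
  moreover have "convex J" using curve by (simp add: integral_curve_def is_interval_convex)
  ultimately obtain a where "\<forall>s\<in>J. f (\<gamma> s) = a"
    using has_derivative_zero_constant[of J "\<lambda>s. f (\<gamma> s)"] by blast
  with s t show "f (\<gamma> s) = f (\<gamma> t)" by simp
qed

section \<open>Conservation of energy\<close>

text \<open>Each form belongs to the span of all of them, which is the annihilator.\<close>

lemma local_annihilating_forms_vanish:
  assumes "local_annihilating_forms A D k U \<eta>" "x \<in> U" "i \<in> {1..k}" "v \<in> D x"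
  shows "\<eta> i x v = 0"
proof -
  have "(\<lambda>v. \<eta> i x v) = (\<lambda>v. \<Sum>l=1..k. (if l = i then 1 else 0) * \<eta> l x v)"
    using assms(3) by (simp add: if_distrib[of "\<lambda>r. r * _"] sum.delta cong: if_cong)
  then have "\<eta> i x \<in> {p. \<exists>a. p = (\<lambda>v. \<Sum>l=1..k. a l * \<eta> l x v)}"
    by (intro CollectI exI)
  also have "\<dots> = annihilator A D x"
    using assms(1,2) unfolding local_annihilating_forms_def by blast
  finally show ?thesis using assms(4) by (simp add: annihilator_def)
qed

lemma linear_on_tangent_lincomb:
  assumes "\<And>i. i \<in> I \<Longrightarrow> linear_on_tangent A x (p i)"
  shows "linear_on_tangent A x (\<lambda>v. \<Sum>i\<in>I. a i * p i v)"
  using assms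
  by (simp add: linear_on_tangent_def sum.distrib sum_distrib_left algebra_simps cong: sum.cong)

theorem proposition1:
  fixes Q :: "('q, 'e::euclidean_space) chart set"
    and H :: "('q, 'e) cotan \<Rightarrow> real"
    and D :: "'q \<Rightarrow> ('q, 'e) tvec set"
    and k :: nat
    and \<B> :: "'q \<Rightarrow> ('q, 'e) tvec \<Rightarrow> ('q, 'e) tvec \<Rightarrow> real"
    and J :: "'j set"
    and U :: "'j \<Rightarrow> 'q set"
    and \<eta> :: "'j \<Rightarrow> nat \<Rightarrow> 'q \<Rightarrow> ('q, 'e) tvec \<Rightarrow> real"
    and lam :: "'j \<Rightarrow> nat \<Rightarrow> ('q, 'e) cotan \<Rightarrow> real"
    and X :: "('q, 'e) cotan \<Rightarrow> (('q, 'e) cotan, 'e \<times> 'e) tvec"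
  defines "T_star_Q \<equiv> cotangent_bundle Q"
    and "D' \<equiv> co_distribution Q H D"
  assumes "smooth_manifold Q"
    and "smooth_along T_star_Q (pts T_star_Q) H"
    and "natural_hamiltonian Q H"
    and "k < DIM('e)"
    and "distribution Q (DIM('e) - k) D"
    and "\<not> integrable_distribution Q D"
    and "(\<Union>j\<in>J. U j) = pts Q"
    and "\<And>j. j \<in> J \<Longrightarrow> local_annihilating_forms Q D k (U j) (\<eta> j)"
    and "closed_two_form Q \<B>"
    and "vector_field_on_submanifold T_star_Q D' X"
    and "\<And>j i. j \<in> J \<Longrightarrow> i \<in> {1..k} \<Longrightarrow> smooth_along T_star_Q (D' \<inter> fst -` U j) (lam j i)"
    and "\<And>j \<alpha> w. j \<in> J \<Longrightarrow> \<alpha> \<in> D' \<Longrightarrow> fst \<alpha> \<in> U j \<Longrightarrow> w \<in> tangent_space T_star_Q \<alpha> \<Longrightarrow>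
           magnetic_form Q \<B> \<alpha> (X \<alpha>) w =
             differential T_star_Q H \<alpha> w + (\<Sum>i=1..k. lam j i \<alpha> * pullback1 Q (\<eta> j i) \<alpha> w)"
  shows "(\<forall>\<alpha>\<in>D'. lie_derivative T_star_Q X H \<alpha> = 0) \<and> preserved_by_flow T_star_Q D' X H"
proof -
  have smooth: "smooth_atlas Q" using assms(3) by (simp add: smooth_manifold_def)
  have A: "differentiable_atlas Q" by (rule smooth_imp_differentiable_atlas[OF smooth])
  have B: "two_form Q \<B>" using assms(11) by (simp add: closed_two_form_def)
  have D'_pts: "D' \<subseteq> pts T_star_Q"
    by (auto simp: D'_def T_star_Q_def co_distribution_def)
  have energy: "lie_derivative T_star_Q X H \<alpha> = 0" if \<alpha>: "\<alpha> \<in> D'" for \<alpha>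
  proof -
    have pts: "\<alpha> \<in> pts (cotangent_bundle Q)" using \<alpha> D'_pts by (auto simp: T_star_Q_def)
    then have "fst \<alpha> \<in> pts Q"
      by (auto simp: pts_def cotangent_bundle_def lift_chart_def)
    then obtain j where j: "j \<in> J" "fst \<alpha> \<in> U j" using assms(9) by blast
    note forms = assms(10)[OF j(1)]
    have X: "X \<alpha> \<in> tangent_space T_star_Q \<alpha>"
      using assms(12) \<alpha> by (simp add: vector_field_on_submanifold_def smooth_vector_field_def)
    let ?\<theta> = "\<lambda>v. \<Sum>i=1..k. lam j i \<alpha> * \<eta> j i (fst \<alpha>) v"
    have eq: "magnetic_form Q \<B> \<alpha> (X \<alpha>) w =
        differential T_star_Q H \<alpha> w + ?\<theta> (proj_tangent Q \<alpha> w)"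
      if "w \<in> tangent_space T_star_Q \<alpha>" for w
      using assms(14)[OF j(1) \<alpha> j(2) that] by (simp only: pullback1_def)
    have "linear_on_tangent Q (fst \<alpha>) ?\<theta>"
      using forms j(2)
      by (intro linear_on_tangent_lincomb)
         (simp add: local_annihilating_forms_def smooth_one_form_def cotangent_space_def)
    then have "proj_tangent Q \<alpha> (X \<alpha>) = fiber_derivative Q H \<alpha>"
      using eq assms(4) unfolding T_star_Q_def
      by (intro proj_magnetic_hamiltonian_vector[OF smooth _ B pts]) auto
    also have "\<dots> \<in> D (fst \<alpha>)" using \<alpha> by (simp add: D'_def co_distribution_def)
    \<comment> \<open>the velocity is admissible, so the reaction forces do no work\<close>
    finally have "?\<theta> (proj_tangent Q \<alpha> (X \<alpha>)) = 0"
      using local_annihilating_forms_vanish[OF forms j(2)] by simp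
    moreover have "magnetic_form Q \<B> \<alpha> (X \<alpha>) (X \<alpha>) = 0"
      by (rule magnetic_form_self[OF A B pts])
    ultimately show ?thesis using eq[OF X] by (simp add: lie_derivative_def)
  qed
  moreover have "preserved_by_flow T_star_Q D' X H"
    using differentiable_atlas_cotangent_bundle[OF smooth] assms(4) D'_pts energy
    unfolding T_star_Q_def by (rule preserved_by_flow_if_lie_derivative_zero)
  ultimately show ?thesis by blast
qed

end
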